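(* Let $(A,\cdot,\circ)$ be a $2$-dimensional Jacobi Novikov-Poisson algebra over $\mathbb{C}$. Then $(A,\cdot,\circ)$ is isomorphic to one of the following Jacobi Novikov-Poisson algebras with basis $\{e_1,e_2\}$, $e_1$ being the identity of $\cdot$, given by the characteristic matrices $\mathcal{A}=(e_i\cdot e_j)_{i,j}$ and $\mathcal{B}=(e_i\circ e_j)_{i,j}$: (J1) $\mathcal{A}=\begin{pmatrix} e_1&e_2\\ e_2&0\end{pmatrix}$, $\mathcal{B}=\begin{pmatrix} k_1e_1&k_2e_2\\ k_1e_2&0\end{pmatrix}$, $k_1,k_2\in\mathbb{C}$; (J2) $\mathcal{A}=\begin{pmatrix} e_1&e_2\\ e_2&0\end{pmatrix}$, $\mathcal{B}=\begin{pmatrix} k_1e_1+e_2&k_2e_2\\ k_1e_2&0\end{pmatrix}$, $k_1,k_2\in\mathbb{C}$; (J3) $\mathcal{A}=\begin{pmatrix} e_1&e_2\\ e_2&e_2\end{pmatrix}$, $\mathcal{B}=\begin{pmatrix} k_1e_1+k_2e_2&(k_1+k_2)e_2\\ (k_1+k_2)e_2&(k_1+k_2)e_2\end{pmatrix}$, $k_1,k_2\in\mathbb{C}$.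
   Context: Binary operations are bilinear. A Novikov algebra $(A,\circ)$ is a vector space with a binary operation satisfying $(a\circ b)\circ c-a\circ(b\circ c)=(b\circ a)\circ c-b\circ(a\circ c)$ and $(a\circ b)\circ c=(a\circ c)\circ b$ for all $a,b,c\in A$. A Jacobi Novikov-Poisson algebra is a triple $(A,\cdot,\circ)$ where $(A,\cdot)$ is a unital commutative associative algebra with identity $1_A$, $(A,\circ)$ is a Novikov algebra, and for all $a,b,c\in A$: $(a\cdot b)\circ c=a\cdot(b\circ c)$ and $c\circ(a\cdot b)=(c\circ a)\cdot b+a\cdot(c\circ b)-a\cdot b\cdot(c\circ 1_A)$. An isomorphism of Jacobi Novikov-Poisson algebras is a bijective linear map that is a homomorphism of both the unital commutative associative algebras and the Novikov algebras. In the matrices, the $(i,j)$ entry is the product $e_i\cdot e_j$ (resp. $e_i\circ e_j$). *)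

theory Defs
  imports "HOL-Analysis.Analysis"
begin

definition bilinear_operation ::
  "('k::field \<Rightarrow> 'a::ab_group_add \<Rightarrow> 'a) \<Rightarrow> ('a \<Rightarrow> 'a \<Rightarrow> 'a) \<Rightarrow> bool" where
  "bilinear_operation smul m \<longleftrightarrow>
     (\<forall>a. Vector_Spaces.linear smul smul (\<lambda>b. m a b)) \<and>
     (\<forall>b. Vector_Spaces.linear smul smul (\<lambda>a. m a b))"

locale unital_comm_assoc_algebra =
  vector_space smul
  for smul :: "'k::field \<Rightarrow> 'a::ab_group_add \<Rightarrow> 'a" +
  fixes mul :: "'a \<Rightarrow> 'a \<Rightarrow> 'a" (infixl "\<cdot>" 70)
    and unit :: 'a
  assumes mult_bilinear: "bilinear_operation smul mul"
    and mult_assoc: "(a \<cdot> b) \<cdot> c = a \<cdot> (b \<cdot> c)"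
    and mult_commute: "a \<cdot> b = b \<cdot> a"
    and unit_mult: "unit \<cdot> a = a"

locale novikov_algebra =
  vector_space smul
  for smul :: "'k::field \<Rightarrow> 'a::ab_group_add \<Rightarrow> 'a" +
  fixes circ :: "'a \<Rightarrow> 'a \<Rightarrow> 'a" (infixl "\<odot>" 70)
  assumes circ_bilinear: "bilinear_operation smul circ"
    and left_symmetric:
      "(a \<odot> b) \<odot> c - a \<odot> (b \<odot> c) = (b \<odot> a) \<odot> c - b \<odot> (a \<odot> c)"
    and right_commutative: "(a \<odot> b) \<odot> c = (a \<odot> c) \<odot> b"

locale jacobi_novikov_poisson_algebra =
  unital_comm_assoc_algebra smul mul unit + novikov_algebra smul circ
  for smul :: "'k::field \<Rightarrow> 'a::ab_group_add \<Rightarrow> 'a"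
    and mul :: "'a \<Rightarrow> 'a \<Rightarrow> 'a" (infixl "\<cdot>" 70)
    and unit :: 'a
    and circ :: "'a \<Rightarrow> 'a \<Rightarrow> 'a" (infixl "\<odot>" 70) +
  assumes mult_circ: "(a \<cdot> b) \<odot> c = a \<cdot> (b \<odot> c)"
    and circ_mult:
      "c \<odot> (a \<cdot> b) = (c \<odot> a) \<cdot> b + a \<cdot> (c \<odot> b) - (a \<cdot> b) \<cdot> (c \<odot> unit)"

locale jacobi_novikov_poisson_isomorphism =
  A: jacobi_novikov_poisson_algebra smulA mulA unitA circA +
  B: jacobi_novikov_poisson_algebra smulB mulB unitB circB
  for smulA :: "'k::field \<Rightarrow> 'a::ab_group_add \<Rightarrow> 'a"
    and mulA unitA circA
    and smulB :: "'k \<Rightarrow> 'b::ab_group_add \<Rightarrow> 'b"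
    and mulB unitB circB +
  fixes f :: "'a \<Rightarrow> 'b"
  assumes f_bij: "bij f"
    and f_linear: "Vector_Spaces.linear smulA smulB f"
    and f_unit: "f unitA = unitB"
    and f_mult: "f (mulA a b) = mulB (f a) (f b)"
    and f_circ: "f (circA a b) = circB (f a) (f b)"

definition e1 :: "complex ^ 2" where "e1 = axis 1 1"
definition e2 :: "complex ^ 2" where "e2 = axis 2 1"

text \<open>
  The \<open>(i, j)\<close> entry of a characteristic matrix is itself a vector, the product of the
  \<open>i\<close>-th and \<open>j\<close>-th basis vectors; the operation is its bilinear extension.
\<close>

definition char_mult ::
  "complex ^ 2 ^ 2 ^ 2 \<Rightarrow> complex ^ 2 \<Rightarrow> complex ^ 2 \<Rightarrow> complex ^ 2" where
  "char_mult M x y = (\<Sum>i\<in>UNIV. \<Sum>j\<in>UNIV. (x $ i * y $ j) *s (M $ i $ j))"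

lemma char_mult_basis: "char_mult M (axis i 1) (axis j 1) = M $ i $ j"
proof -
  have "char_mult M (axis i 1) (axis j 1) =
      (\<Sum>i'\<in>UNIV. \<Sum>j'\<in>UNIV. if i' = i \<and> j' = j then M $ i $ j else 0)"
    unfolding char_mult_def by (intro sum.cong) (auto simp: axis_def)
  also have "\<dots> = (\<Sum>i'\<in>UNIV. if i' = i then M $ i $ j else 0)"
    by (intro sum.cong) auto
  finally show ?thesis by simp
qed

definition matA_J12 :: "complex ^ 2 ^ 2 ^ 2" where
  "matA_J12 = vector [vector [e1, e2],
                      vector [e2, 0]]"

definition matA_J3 :: "complex ^ 2 ^ 2 ^ 2" where
  "matA_J3 = vector [vector [e1, e2],
                     vector [e2, e2]]"

definition matB_J1 :: "complex \<Rightarrow> complex \<Rightarrow> complex ^ 2 ^ 2 ^ 2" where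
  "matB_J1 k1 k2 = vector [vector [k1 *s e1, k2 *s e2],
                           vector [k1 *s e2, 0]]"

definition matB_J2 :: "complex \<Rightarrow> complex \<Rightarrow> complex ^ 2 ^ 2 ^ 2" where
  "matB_J2 k1 k2 = vector [vector [k1 *s e1 + e2, k2 *s e2],
                           vector [k1 *s e2, 0]]"

definition matB_J3 :: "complex \<Rightarrow> complex \<Rightarrow> complex ^ 2 ^ 2 ^ 2" where
  "matB_J3 k1 k2 = vector [vector [k1 *s e1 + k2 *s e2, (k1 + k2) *s e2],
                           vector [(k1 + k2) *s e2, (k1 + k2) *s e2]]"

abbreviation is_JNP_given_by ::
  "complex ^ 2 ^ 2 ^ 2 \<Rightarrow> complex ^ 2 ^ 2 ^ 2 \<Rightarrow> bool" where
  "is_JNP_given_by MA MB \<equiv>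
     jacobi_novikov_poisson_algebra (*s) (char_mult MA) e1 (char_mult MB)"

definition isomorphic_to_JNP_given_by ::
  "(complex \<Rightarrow> 'a::ab_group_add \<Rightarrow> 'a) \<Rightarrow> ('a \<Rightarrow> 'a \<Rightarrow> 'a) \<Rightarrow> 'a \<Rightarrow> ('a \<Rightarrow> 'a \<Rightarrow> 'a) \<Rightarrow>
   complex ^ 2 ^ 2 ^ 2 \<Rightarrow> complex ^ 2 ^ 2 ^ 2 \<Rightarrow> bool" where
  "isomorphic_to_JNP_given_by smul mul unit circ MA MB \<longleftrightarrow>
     (\<exists>f. jacobi_novikov_poisson_isomorphism smul mul unit circ
            (*s) (char_mult MA) e1 (char_mult MB) f)"

end

theory Submission
  imports Defs
begin

text \<open>
  Jacobi Novikov-Poisson structures on a unital commutative associative algebra are the same thing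
  as pairs \<open>(d, \<xi>)\<close> of a derivation \<open>d\<close> and an element \<open>\<xi>\<close>: the compatibility
  \<open>(a \<cdot> b) \<odot> c = a \<cdot> (b \<odot> c)\<close> with \<open>b = 1\<close> gives \<open>a \<odot> c = a \<cdot> (1 \<odot> c)\<close>, and the
  twisted Leibniz rule says precisely that \<open>d b = 1 \<odot> b - \<xi> \<cdot> b\<close>, with \<open>\<xi> = 1 \<odot> 1\<close>, is a
  derivation.  Conversely \<open>a \<odot> b = a \<cdot> (d b + \<xi> \<cdot> b)\<close> satisfies every axiom.  So the task is to
  list the two-dimensional algebras together with their derivations.

  Let \<open>1, v\<close> be a basis.  Completing the square in the quadratic equation of \<open>v\<close> gives a basis
  \<open>1, n\<close> with \<open>n \<cdot> n\<close> equal to \<open>r 1\<close> for a scalar \<open>r\<close>.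

  If \<open>r \<noteq> 0\<close>, let \<open>s\<close> be a square root of \<open>r\<close>; then \<open>e = (1 + n / s) / 2\<close> is an
  idempotent.  A derivation kills every idempotent, so \<open>d = 0\<close>, and the two coordinates of \<open>\<xi>\<close>
  are the parameters of (J3).

  If \<open>r = 0\<close>, then \<open>0 = d (n \<cdot> n) = 2 n \<cdot> d n\<close> forces \<open>d n\<close> to be a multiple of \<open>n\<close>.
  This scalar and the unit coordinate of \<open>\<xi>\<close> determine the two parameters, and the \<open>n\<close>-coordinate
  of \<open>\<xi>\<close> is either \<open>0\<close>, which is (J1), or can be rescaled to \<open>1\<close>, which is (J2).

  The same correspondence shows that the three families consist of Jacobi Novikov-Poisson algebras.
\<close>

section \<open>Structures given by a derivation and an element\<close>

context unital_comm_assoc_algebra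
begin

lemma mul_add_right: "a \<cdot> (b + c) = a \<cdot> b + a \<cdot> c"
  and mul_scale_right: "a \<cdot> smul r b = smul r (a \<cdot> b)"
  using mult_bilinear unfolding bilinear_operation_def Vector_Spaces.linear_iff by blast+

lemma mul_zero_right: "a \<cdot> 0 = 0"
  using mul_add_right [of a 0 0] by simp

lemma mul_diff_right: "a \<cdot> (b - c) = a \<cdot> b - a \<cdot> c"
  using mul_add_right [of a "b - c" c] by simp

lemma mul_add_left: "(a + b) \<cdot> c = a \<cdot> c + b \<cdot> c"
  by (metis mul_add_right mult_commute)

lemma mul_scale_left: "smul r a \<cdot> b = smul r (a \<cdot> b)"
  by (metis mul_scale_right mult_commute)

lemma mult_unit: "a \<cdot> unit = a"
  by (metis mult_commute unit_mult)

lemma mult_left_commute: "a \<cdot> (b \<cdot> c) = b \<cdot> (a \<cdot> c)"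
  by (metis mult_assoc mult_commute)

text \<open>
  Put \<open>D c = d c + \<xi> \<cdot> c\<close>, so that \<open>D (b \<cdot> c) = D b \<cdot> c + b \<cdot> d c\<close>.  Left symmetry holds because
  the associator of \<open>a, b, c\<close> comes out as \<open>- a \<cdot> b \<cdot> d (D c)\<close>, which is symmetric in \<open>a\<close> and
  \<open>b\<close>.  Right commutativity holds because \<open>(a \<cdot> D b) \<cdot> D c\<close> is symmetric in \<open>b\<close> and \<open>c\<close>.
\<close>

lemma jacobi_novikov_poisson_of_derivation:
  assumes lin: "Vector_Spaces.linear smul smul d"
    and leibniz: "\<And>a b. d (a \<cdot> b) = d a \<cdot> b + a \<cdot> d b"
  shows "jacobi_novikov_poisson_algebra smul mul unit (\<lambda>a b. a \<cdot> (d b + \<xi> \<cdot> b))"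
proof -
  have d_add: "d (a + b) = d a + d b" and d_scale: "d (smul r a) = smul r (d a)" for a b r
    using lin unfolding Vector_Spaces.linear_iff by blast+
  have "d unit = d unit + d unit"
    using leibniz [of unit unit] by (simp add: unit_mult mult_unit)
  then have d_unit: "d unit = 0" by simp
  note vs = vector_space_axioms
  show ?thesis
    by unfold_locales
      (auto simp: bilinear_operation_def Vector_Spaces.linear_iff vs d_add d_scale d_unit leibniz
        mul_add_right mul_add_left mul_scale_right mul_scale_left scale_right_distrib
        mult_unit mult_assoc mult_commute mult_left_commute algebra_simps)
qed

end

context jacobi_novikov_poisson_algebra
begin

definition derivation_part :: "'a \<Rightarrow> 'a"
  where "derivation_part b = unit \<odot> b - (unit \<odot> unit) \<cdot> b"

lemma circ_eq: "a \<odot> b = a \<cdot> (derivation_part b + (unit \<odot> unit) \<cdot> b)"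
  using mult_circ [of a unit b] by (simp add: derivation_part_def mult_unit)

lemma derivation_part_mult:
  "derivation_part (a \<cdot> b) = derivation_part a \<cdot> b + a \<cdot> derivation_part b"
proof -
  have *: "(x - y) \<cdot> b = x \<cdot> b - y \<cdot> b" for x y
    by (metis mul_diff_right mult_commute)
  show ?thesis
    by (simp add: derivation_part_def circ_mult mul_diff_right * mult_assoc mult_commute
        mult_left_commute)
qed

lemma derivation_part_unit: "derivation_part unit = 0"
  by (simp add: derivation_part_def mult_unit)

lemma derivation_part_zero: "derivation_part 0 = 0"
  using derivation_part_mult [of 0 0] by (simp add: mul_zero_right mult_commute [of 0 "derivation_part 0"])

text \<open>
  Applying the Leibniz rule to \<open>e \<cdot> e = e\<close> gives \<open>d e = 2 e \<cdot> d e\<close>; multiplying this by \<open>e\<close> gives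
  \<open>e \<cdot> d e = 2 e \<cdot> d e\<close>, so \<open>e \<cdot> d e = 0\<close> and hence \<open>d e = 0\<close>, in any characteristic.
\<close>

lemma derivation_part_idempotent:
  assumes "e \<cdot> e = e"
  shows "derivation_part e = 0"
proof -
  let ?d = "derivation_part e"
  have *: "?d = e \<cdot> ?d + e \<cdot> ?d"
    using derivation_part_mult [of e e] by (simp add: assms mult_commute)
  have "e \<cdot> ?d = e \<cdot> ?d + e \<cdot> ?d"
    by (metis * assms mul_add_right mult_assoc)
  with * show ?thesis by simp
qed

end

section \<open>The three families\<close>

lemma char_mult_2:
  fixes x y :: "complex ^ 2"
  shows "char_mult M x y =
    (x $ 1 * y $ 1) *s M $ 1 $ 1 + (x $ 1 * y $ 2) *s M $ 1 $ 2 +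
    ((x $ 2 * y $ 1) *s M $ 2 $ 1 + (x $ 2 * y $ 2) *s M $ 2 $ 2)"
  by (simp add: char_mult_def sum_2)

lemma e1_nth: "e1 $ 1 = 1" "e1 $ 2 = 0"
  and e2_nth: "e2 $ 1 = 0" "e2 $ 2 = 1"
  by (simp_all add: e1_def e2_def axis_def)

lemmas coordinates_2 = vec_eq_iff forall_2 char_mult_2 e1_nth e2_nth
  matA_J12_def matA_J3_def matB_J1_def matB_J2_def matB_J3_def

lemma unital_comm_assoc_J12: "unital_comm_assoc_algebra (*s) (char_mult matA_J12) e1"
  by unfold_locales
    (auto simp: bilinear_operation_def Vector_Spaces.linear_iff vec.vector_space_axioms
      coordinates_2 algebra_simps)

lemma unital_comm_assoc_J3: "unital_comm_assoc_algebra (*s) (char_mult matA_J3) e1"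
  by unfold_locales
    (auto simp: bilinear_operation_def Vector_Spaces.linear_iff vec.vector_space_axioms
      coordinates_2 algebra_simps)

text \<open>
  The derivations of \<open>\<complex>[e\<^sub>2] / (e\<^sub>2\<^sup>2)\<close> are the maps that kill \<open>e\<^sub>1\<close> and multiply \<open>e\<^sub>2\<close> by a
  scalar \<open>\<beta>\<close>; the matrices (J1) and (J2) correspond to \<open>\<beta> = k\<^sub>2 - k\<^sub>1\<close> and to \<open>\<xi> = k\<^sub>1 e\<^sub>1\<close>
  and \<open>\<xi> = k\<^sub>1 e\<^sub>1 + e\<^sub>2\<close>, respectively.
\<close>

lemma J12_jacobi_novikov_poisson:
  fixes \<beta> :: complex and \<xi> :: "complex ^ 2"
  shows "jacobi_novikov_poisson_algebra (*s) (char_mult matA_J12) e1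
    (\<lambda>x y. char_mult matA_J12 x ((\<beta> * y $ 2) *s e2 + char_mult matA_J12 \<xi> y))"
  by (rule unital_comm_assoc_algebra.jacobi_novikov_poisson_of_derivation
        [OF unital_comm_assoc_J12])
    (auto simp: Vector_Spaces.linear_iff vec.vector_space_axioms coordinates_2 algebra_simps)

lemma J1_jacobi_novikov_poisson: "is_JNP_given_by matA_J12 (matB_J1 k1 k2)"
proof -
  have "char_mult (matB_J1 k1 k2) = (\<lambda>x y. char_mult matA_J12 x
      (((k2 - k1) * y $ 2) *s e2 + char_mult matA_J12 (k1 *s e1) y))"
    by (intro ext) (simp add: coordinates_2 algebra_simps)
  then show ?thesis by (simp only: J12_jacobi_novikov_poisson)
qed

lemma J2_jacobi_novikov_poisson: "is_JNP_given_by matA_J12 (matB_J2 k1 k2)"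
proof -
  have "char_mult (matB_J2 k1 k2) = (\<lambda>x y. char_mult matA_J12 x
      (((k2 - k1) * y $ 2) *s e2 + char_mult matA_J12 (k1 *s e1 + e2) y))"
    by (intro ext) (simp add: coordinates_2 algebra_simps)
  then show ?thesis by (simp only: J12_jacobi_novikov_poisson)
qed

text \<open>Here \<open>e\<^sub>1\<close> and \<open>e\<^sub>2\<close> are idempotents that span the algebra, so the derivation is \<open>0\<close>.\<close>

lemma J3_jacobi_novikov_poisson: "is_JNP_given_by matA_J3 (matB_J3 k1 k2)"
proof -
  have "char_mult (matB_J3 k1 k2) = (\<lambda>x y. char_mult matA_J3 x
      (0 + char_mult matA_J3 (k1 *s e1 + k2 *s e2) y))"
    by (intro ext) (simp add: coordinates_2 algebra_simps)
  moreover have "jacobi_novikov_poisson_algebra (*s) (char_mult matA_J3) e1 \<dots>"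
    by (rule unital_comm_assoc_algebra.jacobi_novikov_poisson_of_derivation
        [OF unital_comm_assoc_J3])
      (auto simp: Vector_Spaces.linear_iff vec.vector_space_axioms coordinates_2)
  ultimately show ?thesis by simp
qed

section \<open>Bases and isomorphisms\<close>

definition comb :: "(complex \<Rightarrow> 'a::ab_group_add \<Rightarrow> 'a) \<Rightarrow> 'a \<Rightarrow> 'a \<Rightarrow> complex ^ 2 \<Rightarrow> 'a"
  where "comb smul u v x = smul (x $ 1) u + smul (x $ 2) v"

text \<open>
  Bijectivity of the coordinate map is used as the notion of basis throughout: it yields coordinates
  of an element, uniqueness of coordinates, and, by inversion, the isomorphism.
\<close>

abbreviation is_basis :: "(complex \<Rightarrow> 'a::ab_group_add \<Rightarrow> 'a) \<Rightarrow> 'a \<Rightarrow> 'a \<Rightarrow> bool"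
  where "is_basis smul u v \<equiv> bij (comb smul u v)"

lemma linear_comb:
  assumes "vector_space smul"
  shows "Vector_Spaces.linear (*s) smul (comb smul u v)"
proof -
  interpret vector_space smul by fact
  show ?thesis
    by (simp add: Vector_Spaces.linear_iff vec.vector_space_axioms vector_space_axioms comb_def
        scale_left_distrib scale_right_distrib)
qed

lemma is_basis_change:
  assumes "vector_space smul" "is_basis smul u v" "\<beta> \<noteq> 0"
  shows "is_basis smul u (smul \<alpha> u + smul \<beta> v)"
proof -
  interpret vector_space smul by fact
  let ?t = "\<lambda>x :: complex ^ 2. vector [x $ 1 + \<alpha> * x $ 2, \<beta> * x $ 2] :: complex ^ 2"
  let ?t' = "\<lambda>x :: complex ^ 2. vector [x $ 1 - \<alpha> / \<beta> * x $ 2, x $ 2 / \<beta>] :: complex ^ 2"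
  have "?t \<circ> ?t' = id" "?t' \<circ> ?t = id"
    using \<open>\<beta> \<noteq> 0\<close> by (auto simp: fun_eq_iff vec_eq_iff forall_2 field_simps)
  then have "bij ?t" by (rule o_bij [rotated])
  then have "bij (comb smul u v \<circ> ?t)"
    using assms(2) by (rule bij_comp)
  moreover have "comb smul u (smul \<alpha> u + smul \<beta> v) = comb smul u v \<circ> ?t"
    by (simp add: fun_eq_iff comb_def scale_left_distrib scale_right_distrib mult.commute add.assoc)
  ultimately show ?thesis
    by (simp only:)
qed

lemma is_basisE:
  assumes "is_basis smul u v"
  obtains \<alpha> \<beta> where "x = smul \<alpha> u + smul \<beta> v"
proof -
  obtain y where "x = comb smul u v y"
    using surjD [OF bij_is_surj [OF assms]] by blast
  then show ?thesis
    using that unfolding comb_def by blast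
qed

lemma is_basis_nonzero:
  assumes "vector_space smul" "is_basis smul u v"
  shows "v \<noteq> 0"
proof
  interpret vector_space smul by fact
  assume "v = 0"
  then have "comb smul u v e2 = comb smul u v 0"
    by (simp add: comb_def e2_nth)
  then have "e2 = 0"
    by (rule injD [OF bij_is_inj [OF assms(2)]])
  then show False
    using e2_nth by simp
qed

lemma is_basis_of_dim_2:
  fixes smul :: "complex \<Rightarrow> 'a::ab_group_add \<Rightarrow> 'a"
  assumes "vector_space smul" "vector_space.dim smul (UNIV :: 'a set) = 2" "u \<noteq> 0"
  obtains v where "is_basis smul u v"
proof -
  interpret vector_space smul by fact
  have "independent {u}"
    using assms(3) by simp
  then obtain B where B: "{u} \<subseteq> B" "independent B" "UNIV \<subseteq> span B"
    by (rule maximal_independent_subset_extend [OF subset_UNIV])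
  have "card B = 2"
    using basis_card_eq_dim [OF subset_UNIV B(3,2)] assms(2) by simp
  then obtain a b where "B = {a, b}" "a \<noteq> b"
    by (auto simp: card_2_iff)
  then obtain v where v: "B = {u, v}" "u \<noteq> v"
    using B(1) by blast
  have "inj (comb smul u v)"
  proof (rule injI)
    fix x y :: "complex ^ 2"
    assume "comb smul u v x = comb smul u v y"
    then have "smul (x $ 1 - y $ 1) u + smul (x $ 2 - y $ 2) v = 0"
      by (simp add: comb_def scale_left_diff_distrib algebra_simps)
    then have sum0: "(\<Sum>w\<in>B. smul ((if w = u then x $ 1 - y $ 1 else x $ 2 - y $ 2)) w) = 0"
      using v by simp
    have "(if w = u then x $ 1 - y $ 1 else x $ 2 - y $ 2) = 0" if "w \<in> B" for w
      by (rule independentD [OF B(2) _ order_refl sum0 that]) (simp add: v)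
    from this [of u] this [of v] show "x = y"
      using v by (auto simp: vec_eq_iff forall_2)
  qed
  moreover have "surj (comb smul u v)"
    unfolding surj_def
  proof
    fix z
    have "z \<in> span {u, v}" using B v by auto
    then obtain p q where "z = smul p u + smul q v"
      by (auto simp: span_insert span_singleton algebra_simps)
    then have "z = comb smul u v (vector [p, q])"
      by (simp add: comb_def)
    then show "\<exists>x. z = comb smul u v x" by blast
  qed
  ultimately show ?thesis
    using that by (auto simp: bij_def)
qed

text \<open>By bilinearity, a multiplication table determines the operation.\<close>

lemma comb_char_mult:
  assumes vs: "vector_space smul" and bilin: "bilinear_operation smul m"
    and table: "comb smul u v (M $ 1 $ 1) = m u u" "comb smul u v (M $ 1 $ 2) = m u v"
      "comb smul u v (M $ 2 $ 1) = m v u" "comb smul u v (M $ 2 $ 2) = m v v"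
  shows "comb smul u v (char_mult M x y) = m (comb smul u v x) (comb smul u v y)"
proof -
  interpret vector_space smul by fact
  have m: "m (a + b) c = m a c + m b c" "m a (b + c) = m a b + m a c"
    "m (smul r a) b = smul r (m a b)" "m a (smul r b) = smul r (m a b)" for a b c r
    using bilin unfolding bilinear_operation_def Vector_Spaces.linear_iff by blast+
  have lin: "comb smul u v (a + b) = comb smul u v a + comb smul u v b"
    "comb smul u v (r *s a) = smul r (comb smul u v a)" for a b r
    using linear_comb [OF vs] unfolding Vector_Spaces.linear_iff by blast+
  have "comb smul u v (char_mult M x y) =
      smul (x $ 1 * y $ 1) (m u u) + smul (x $ 1 * y $ 2) (m u v) +
      (smul (x $ 2 * y $ 1) (m v u) + smul (x $ 2 * y $ 2) (m v v))"
    by (simp add: char_mult_2 lin table)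
  also have "\<dots> = m (comb smul u v x) (comb smul u v y)"
    by (simp add: comb_def [of smul u v x] comb_def [of smul u v y] m scale_right_distrib
        mult.commute algebra_simps)
  finally show ?thesis .
qed

context jacobi_novikov_poisson_algebra
begin

lemma unit_nonzero_of_dim_2:
  assumes "dim (UNIV :: 'a set) = 2"
  shows "unit \<noteq> 0"
proof
  assume "unit = 0"
  then have "a = 0" for a :: 'a
    by (metis mult_unit mul_zero_right)
  then have "(UNIV :: 'a set) \<subseteq> {0}" by auto
  then have "dim (UNIV :: 'a set) \<le> card ({} :: 'a set)"
    by (intro dim_le_card) auto
  with assms show False by simp
qed

end

text \<open>
  The isomorphism is the inverse of the coordinate map: it is enough that the source, in the basis
  \<open>unit, v\<close>, has the multiplication tables \<open>MA\<close> and \<open>MB\<close>.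
\<close>

lemma isomorphic_of_table:
  assumes jnp: "jacobi_novikov_poisson_algebra smul mul unit circ"
    and target: "is_JNP_given_by MA MB"
    and basis: "is_basis smul unit v"
    and mul_table: "comb smul unit v (MA $ 1 $ 1) = mul unit unit"
      "comb smul unit v (MA $ 1 $ 2) = mul unit v"
      "comb smul unit v (MA $ 2 $ 1) = mul v unit"
      "comb smul unit v (MA $ 2 $ 2) = mul v v"
    and circ_table: "comb smul unit v (MB $ 1 $ 1) = circ unit unit"
      "comb smul unit v (MB $ 1 $ 2) = circ unit v"
      "comb smul unit v (MB $ 2 $ 1) = circ v unit"
      "comb smul unit v (MB $ 2 $ 2) = circ v v"
  shows "isomorphic_to_JNP_given_by smul mul unit circ MA MB"
proof -
  interpret jacobi_novikov_poisson_algebra smul mul unit circ by fact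
  note vs = vector_space_axioms
  let ?g = "comb smul unit v"
  define f where "f = inv ?g"
  have g_f: "?g (f a) = a" and f_g: "f (?g x) = x" for a x
    using basis by (simp_all add: f_def bij_is_surj surj_f_inv_f bij_is_inj)
  have f_eqI: "f a = x" if "?g x = a" for a x
    using f_g that by blast
  have "bij f"
    using basis by (simp add: f_def bij_imp_bij_inv)
  have g_add: "?g (x + y) = ?g x + ?g y" and g_scale: "?g (r *s x) = smul r (?g x)" for x y r
    using linear_comb [OF vs] unfolding Vector_Spaces.linear_iff by blast+
  have linear: "Vector_Spaces.linear smul (*s) f"
    unfolding Vector_Spaces.linear_iff
    by (auto intro!: f_eqI simp: vs vec.vector_space_axioms g_add g_scale g_f)
  have unit: "f unit = e1"
    by (rule f_eqI) (simp add: comb_def e1_nth)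
  have mult: "f (mul a b) = char_mult MA (f a) (f b)" for a b
    by (rule f_eqI) (simp add: comb_char_mult [where m = mul, OF vs mult_bilinear mul_table] g_f)
  have circ: "f (circ a b) = char_mult MB (f a) (f b)" for a b
    by (rule f_eqI) (simp add: comb_char_mult [where m = circ, OF vs circ_bilinear circ_table] g_f)
  have "jacobi_novikov_poisson_isomorphism smul mul unit circ
      (*s) (char_mult MA) e1 (char_mult MB) f"
    by (intro jacobi_novikov_poisson_isomorphism.intro
        jacobi_novikov_poisson_isomorphism_axioms.intro jnp target \<open>bij f\<close> linear unit mult circ)
  then show ?thesis
    unfolding isomorphic_to_JNP_given_by_def by blast
qed

section \<open>Classification\<close>

text \<open>
  Completing the square makes the square of the second basis vector a scalar.  If the scalar is not
  \<open>0\<close>, its square roots exist over \<open>\<complex>\<close>, so the algebra splits as \<open>\<complex> \<times> \<complex>\<close> and contains a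
  nontrivial idempotent.
\<close>

lemma two_dimensional_algebra_cases:
  fixes smul :: "complex \<Rightarrow> 'a::ab_group_add \<Rightarrow> 'a"
  assumes "unital_comm_assoc_algebra smul mul unit" "is_basis smul unit v"
  obtains (square_zero) n where "is_basis smul unit n" "mul n n = 0"
  | (idempotent) e where "is_basis smul unit e" "mul e e = e"
proof -
  interpret unital_comm_assoc_algebra smul mul unit by fact
  note vs = vector_space_axioms
  have square: "mul (smul \<alpha> unit + smul \<beta> x) (smul \<alpha> unit + smul \<beta> x) =
      smul (\<alpha> * \<alpha>) unit + smul (2 * \<alpha> * \<beta>) x + smul (\<beta> * \<beta>) (mul x x)" for \<alpha> \<beta> x
  proof -
    have "smul (2 * \<alpha> * \<beta>) x = smul (\<alpha> * \<beta>) x + smul (\<alpha> * \<beta>) x"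
      by (simp flip: scale_left_distrib)
    then show ?thesis
      by (simp add: mul_add_left mul_add_right mul_scale_left mul_scale_right unit_mult mult_unit
          scale_right_distrib mult.commute [of \<beta> \<alpha>] algebra_simps)
  qed
  obtain p q where v: "mul v v = smul p unit + smul q v"
    using is_basisE [OF assms(2)] .
  define n where "n = smul (- q / 2) unit + smul 1 v"
  define r where "r = p + q\<^sup>2 / 4"
  have n: "is_basis smul unit n"
    unfolding n_def by (rule is_basis_change [OF vs assms(2)]) simp
  have nn: "mul n n = smul r unit"
    unfolding n_def square
    by (simp add: v r_def scale_left_distrib power2_eq_square)
  show ?thesis
  proof (cases "r = 0")
    case True
    with n nn show ?thesis by (intro square_zero) auto
  next
    case False
    define s where "s = csqrt r"
    have s: "s * s = r" "s \<noteq> 0"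
      using False by (auto simp: s_def simp flip: power2_eq_square)
    define e where "e = smul (1 / 2) unit + smul (1 / (2 * s)) n"
    have "is_basis smul unit e"
      unfolding e_def using s by (intro is_basis_change [OF vs n]) simp
    moreover have "mul e e = e"
    proof -
      have "mul e e = smul (1 / 4 + r / (4 * (s * s))) unit + smul (1 / (2 * s)) n"
        unfolding e_def square by (simp add: nn scale_left_distrib algebra_simps)
      also have "1 / 4 + r / (4 * (s * s)) = 1 / 2"
        using s False by (simp add: field_simps)
      finally show ?thesis by (simp add: e_def)
    qed
    ultimately show ?thesis by (rule idempotent)
  qed
qed

text \<open>
  Write \<open>d n = \<alpha> 1 + \<beta> n\<close>.  The Leibniz rule for \<open>n \<cdot> n = 0\<close> gives \<open>2 \<alpha> n = 0\<close>, so \<open>\<alpha> = 0\<close>.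
  With \<open>\<xi> = k\<^sub>1 1 + b n\<close> the table of \<open>\<odot>\<close> follows, where \<open>k\<^sub>2 = \<beta> + k\<^sub>1\<close>.
\<close>

lemma square_zero_structure:
  fixes smul :: "complex \<Rightarrow> 'a::ab_group_add \<Rightarrow> 'a"
  assumes "jacobi_novikov_poisson_algebra smul mul unit circ"
    and basis: "is_basis smul unit n" and nn: "mul n n = 0"
  obtains k1 k2 b where "circ unit unit = smul k1 unit + smul b n"
    "circ unit n = smul k2 n" "circ n unit = smul k1 n" "circ n n = 0"
proof -
  interpret jacobi_novikov_poisson_algebra smul mul unit circ by fact
  note expand = mul_add_left mul_add_right mul_scale_left mul_scale_right unit_mult mult_unit
    scale_right_distrib
  have "n \<noteq> 0"
    by (rule is_basis_nonzero [OF vector_space_axioms basis])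
  obtain k1 b where \<xi>: "circ unit unit = smul k1 unit + smul b n"
    using is_basisE [OF basis] .
  obtain \<alpha> \<beta> where d: "derivation_part n = smul \<alpha> unit + smul \<beta> n"
    using is_basisE [OF basis] .
  have "smul (2 * \<alpha>) n = mul (derivation_part n) n + mul n (derivation_part n)"
    by (simp add: d expand nn flip: scale_left_distrib)
  also have "\<dots> = 0"
    using derivation_part_mult [of n n] by (simp add: nn derivation_part_zero)
  finally have "\<alpha> = 0"
    using \<open>n \<noteq> 0\<close> by simp
  then have dn: "derivation_part n = smul \<beta> n"
    using d by simp
  show ?thesis
  proof
    show "circ unit unit = smul k1 unit + smul b n" by fact
    show "circ unit n = smul (\<beta> + k1) n"
      by (simp add: circ_eq [of unit n] dn \<xi> expand nn scale_left_distrib)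
    show "circ n unit = smul k1 n"
      by (simp add: circ_eq [of n unit] derivation_part_unit \<xi> expand nn)
    show "circ n n = 0"
      by (simp add: circ_eq [of n n] dn \<xi> expand nn)
  qed
qed

text \<open>
  Replacing \<open>n\<close> by \<open>b n\<close> when \<open>b \<noteq> 0\<close> turns the coefficient of \<open>n\<close> in \<open>unit \<odot> unit\<close> into \<open>1\<close>
  and preserves the other entries of the table, since they are homogeneous in \<open>n\<close>.
\<close>

lemma isomorphic_J1_or_J2:
  fixes smul :: "complex \<Rightarrow> 'a::ab_group_add \<Rightarrow> 'a"
  assumes jnp: "jacobi_novikov_poisson_algebra smul mul unit circ"
    and basis: "is_basis smul unit n" and nn: "mul n n = 0"
  shows "\<exists>k1 k2. isomorphic_to_JNP_given_by smul mul unit circ matA_J12 (matB_J1 k1 k2) \<or>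
                 isomorphic_to_JNP_given_by smul mul unit circ matA_J12 (matB_J2 k1 k2)"
proof -
  interpret jacobi_novikov_poisson_algebra smul mul unit circ by fact
  note comb = comb_def coordinates_2 unit_mult mult_unit
  obtain k1 k2 b where table: "circ unit unit = smul k1 unit + smul b n"
    "circ unit n = smul k2 n" "circ n unit = smul k1 n" "circ n n = 0"
    using square_zero_structure [OF jnp basis nn] .
  show ?thesis
  proof (cases "b = 0")
    case True
    have "isomorphic_to_JNP_given_by smul mul unit circ matA_J12 (matB_J1 k1 k2)"
      by (rule isomorphic_of_table [OF jnp J1_jacobi_novikov_poisson basis])
        (simp_all add: comb nn table True)
    then show ?thesis by blast
  next
    case False
    define n' where "n' = smul b n"
    have basis': "is_basis smul unit n'"
      using is_basis_change [OF vector_space_axioms basis False, of 0] by (simp add: n'_def)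
    have circ_scale: "circ (smul r x) y = smul r (circ x y)"
      "circ x (smul r y) = smul r (circ x y)" for r x y
      using circ_bilinear unfolding bilinear_operation_def Vector_Spaces.linear_iff by blast+
    have table': "mul n' n' = 0" "circ unit unit = smul k1 unit + n'"
      "circ unit n' = smul k2 n'" "circ n' unit = smul k1 n'" "circ n' n' = 0"
      by (simp_all add: n'_def nn mul_scale_left mul_scale_right circ_scale table mult.commute)
    have "isomorphic_to_JNP_given_by smul mul unit circ matA_J12 (matB_J2 k1 k2)"
      by (rule isomorphic_of_table [OF jnp J2_jacobi_novikov_poisson basis'])
        (simp_all add: comb table')
    then show ?thesis by blast
  qed
qed

text \<open>
  As \<open>unit\<close> and \<open>e\<close> are killed by the derivation, \<open>a \<odot> b = a \<cdot> \<xi> \<cdot> b\<close> on them, and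
  \<open>\<xi> = k\<^sub>1 1 + k\<^sub>2 e\<close> acts on \<open>e\<close> as the scalar \<open>k\<^sub>1 + k\<^sub>2\<close>.
\<close>

lemma isomorphic_J3:
  fixes smul :: "complex \<Rightarrow> 'a::ab_group_add \<Rightarrow> 'a"
  assumes jnp: "jacobi_novikov_poisson_algebra smul mul unit circ"
    and basis: "is_basis smul unit e" and ee: "mul e e = e"
  shows "\<exists>k1 k2. isomorphic_to_JNP_given_by smul mul unit circ matA_J3 (matB_J3 k1 k2)"
proof -
  interpret jacobi_novikov_poisson_algebra smul mul unit circ by fact
  obtain k1 k2 where \<xi>: "circ unit unit = smul k1 unit + smul k2 e"
    using is_basisE [OF basis] .
  have "circ a b = mul a (mul (smul k1 unit + smul k2 e) b)" if "b = unit \<or> b = e" for a b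
    using that circ_eq [of a b] by (auto simp: derivation_part_unit derivation_part_idempotent ee \<xi>)
  then have table: "circ unit e = smul (k1 + k2) e" "circ e unit = smul (k1 + k2) e"
    "circ e e = smul (k1 + k2) e"
    by (simp_all add: mul_add_left mul_add_right mul_scale_left mul_scale_right unit_mult mult_unit
        ee scale_left_distrib)
  have "isomorphic_to_JNP_given_by smul mul unit circ matA_J3 (matB_J3 k1 k2)"
    by (rule isomorphic_of_table [OF jnp J3_jacobi_novikov_poisson basis])
      (simp_all add: comb_def coordinates_2 unit_mult mult_unit ee table \<xi>)
  then show ?thesis by blast
qed

theorem proposition2p10:
  fixes smul :: "complex \<Rightarrow> 'a::ab_group_add \<Rightarrow> 'a"
    and mul circ :: "'a \<Rightarrow> 'a \<Rightarrow> 'a" and unit :: 'a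
  assumes "jacobi_novikov_poisson_algebra smul mul unit circ"
    and "vector_space.dim smul (UNIV :: 'a set) = 2"
  shows "(\<forall>k1 k2. is_JNP_given_by matA_J12 (matB_J1 k1 k2) \<and>
                  is_JNP_given_by matA_J12 (matB_J2 k1 k2) \<and>
                  is_JNP_given_by matA_J3 (matB_J3 k1 k2)) \<and>
         (\<exists>k1 k2. isomorphic_to_JNP_given_by smul mul unit circ matA_J12 (matB_J1 k1 k2) \<or>
                  isomorphic_to_JNP_given_by smul mul unit circ matA_J12 (matB_J2 k1 k2) \<or>
                  isomorphic_to_JNP_given_by smul mul unit circ matA_J3 (matB_J3 k1 k2))"
proof (intro conjI allI J1_jacobi_novikov_poisson J2_jacobi_novikov_poisson
    J3_jacobi_novikov_poisson)
  interpret jacobi_novikov_poisson_algebra smul mul unit circ by fact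
  obtain v where "is_basis smul unit v"
    using is_basis_of_dim_2 [OF vector_space_axioms assms(2) unit_nonzero_of_dim_2 [OF assms(2)]] .
  with unital_comm_assoc_algebra_axioms
  show "\<exists>k1 k2. isomorphic_to_JNP_given_by smul mul unit circ matA_J12 (matB_J1 k1 k2) \<or>
                isomorphic_to_JNP_given_by smul mul unit circ matA_J12 (matB_J2 k1 k2) \<or>
                isomorphic_to_JNP_given_by smul mul unit circ matA_J3 (matB_J3 k1 k2)"
  proof (cases rule: two_dimensional_algebra_cases)
    case (square_zero n)
    then show ?thesis using isomorphic_J1_or_J2 [OF assms(1)] by blast
  next
    case (idempotent e)
    then show ?thesis using isomorphic_J3 [OF assms(1)] by blast
  qed
qed

end
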